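(* Let $k,m,s,t\in\mathbb{N}$ with $s\ge2$ and $0<t<s$, let $p\in(0,2]$ and $\lambda\in(0,\infty)$, and let $R_2=R^{p,m,k}_{\lambda,s,t}$ be the unique root in $(0,1)$ of the equation $\Psi_2(r)=0$, where $$\Psi_2(r)=2\lambda\frac{r^{k(s+t)}}{1-r^{ks}}-p\,\frac{1-r^m}{1+r^m}.$$ Let $f(z)=\sum_{j=0}^\infty a_jz^j\in\mathcal{B}$ and let $\omega_n\in\mathcal{B}_n$ for $n\ge1$. Then $$B_f(z):=|f(\omega_m(z))|^p+\lambda\sum_{j=1}^\infty|a_{sj+t}|\,|\omega_k(z)|^{sj+t}\le1\qquad\text{for }|z|=r\le R_2 .$$ In the case when $\Psi_2(r)>0$ in some interval $(R_2,R_2+\varepsilon)$, $\varepsilon>0$, the number $R_2$ cannot be improved: for every $R\in(R_2,1)$ there exist such $f$ and $\omega_n$ ($n\ge1$) and a point $z$ with $|z|\le R$ such that $B_f(z)>1$.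
   Context: $\mathbb{N}=\{1,2,\dots\}$ and $\mathbb{D}=\{z\in\mathbb{C}:|z|<1\}$. $\mathcal{B}$ is the class of analytic functions $f$ on $\mathbb{D}$ with $\sup_{z\in\mathbb{D}}|f(z)|\le 1$. For $n\in\mathbb{N}$, $\mathcal{B}_n=\{\omega\in\mathcal{B}:\omega(0)=\cdots=\omega^{(n-1)}(0)=0,\ \omega^{(n)}(0)\ne0\}$. *)

theory Defs
  imports "HOL-Complex_Analysis.Complex_Analysis"
begin

definition unit_ball_class :: "(complex \<Rightarrow> complex) set" where
  "unit_ball_class = {f. f analytic_on ball 0 1 \<and> (\<forall>z\<in>ball 0 1. norm (f z) \<le> 1)}"

definition unit_ball_class_order :: "nat \<Rightarrow> (complex \<Rightarrow> complex) set" where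
  "unit_ball_class_order n =
     {\<omega> \<in> unit_ball_class. (\<forall>i<n. (deriv ^^ i) \<omega> 0 = 0) \<and> (deriv ^^ n) \<omega> 0 \<noteq> 0}"

definition is_power_series_of :: "(nat \<Rightarrow> complex) \<Rightarrow> (complex \<Rightarrow> complex) \<Rightarrow> bool" where
  "is_power_series_of a f \<longleftrightarrow> (\<forall>z\<in>ball 0 1. (\<lambda>j. a j * z ^ j) sums f z)"

definition Psi2 :: "real \<Rightarrow> real \<Rightarrow> nat \<Rightarrow> nat \<Rightarrow> nat \<Rightarrow> nat \<Rightarrow> real \<Rightarrow> real" where
  "Psi2 p lam k m s t r =
     2 * lam * (r ^ (k * (s + t)) / (1 - r ^ (k * s))) - p * ((1 - r ^ m) / (1 + r ^ m))"

definition R2 :: "real \<Rightarrow> real \<Rightarrow> nat \<Rightarrow> nat \<Rightarrow> nat \<Rightarrow> nat \<Rightarrow> real" where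
  "R2 p lam k m s t = (THE r. 0 < r \<and> r < 1 \<and> Psi2 p lam k m s t r = 0)"

(* Terms of the series over j = 1, 2, ..., shifted so that the index starts at 0. *)
definition bohr_term ::
    "nat \<Rightarrow> nat \<Rightarrow> nat \<Rightarrow> (nat \<Rightarrow> complex) \<Rightarrow> (nat \<Rightarrow> complex \<Rightarrow> complex) \<Rightarrow> complex \<Rightarrow> nat \<Rightarrow> real" where
  "bohr_term k s t a \<omega> z j =
     norm (a (s * Suc j + t)) * norm (\<omega> k z) ^ (s * Suc j + t)"

(* Meaningful only when the series converges, since suminf is unspecified otherwise. *)
definition bohr_sum ::
    "real \<Rightarrow> real \<Rightarrow> nat \<Rightarrow> nat \<Rightarrow> nat \<Rightarrow> nat \<Rightarrow> (complex \<Rightarrow> complex) \<Rightarrow> (nat \<Rightarrow> complex) \<Rightarrow>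
     (nat \<Rightarrow> complex \<Rightarrow> complex) \<Rightarrow> complex \<Rightarrow> real" where
  "bohr_sum p lam k m s t f a \<omega> z =
     norm (f (\<omega> m z)) powr p + lam * (\<Sum>j. bohr_term k s t a \<omega> z j)"

end

theory Submission
  imports Defs
begin

text \<open>By the Schwarz lemma \<open>|\<omega>_n(z)| \<le> r^n\<close>. With \<open>A = |a_0|\<close> and \<open>x = r^m\<close>, the coefficient bound
  \<open>|a_j| \<le> 1 - A\<^sup>2\<close> and \<open>\<Psi>_2(r) \<le> 0\<close> bound the weighted sum by \<open>(p/2) (1 - A\<^sup>2) (1 - x)/(1 + x)\<close>, which by
  Schwarz-Pick is at most \<open>(p/2) (1 - u\<^sup>2)\<close> for \<open>u = |f(\<omega>_m(z))|\<close>; since \<open>p \<le> 2\<close>, concavity gives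
  \<open>u^p \<le> 1 - (p/2) (1 - u\<^sup>2)\<close>.
  For sharpness take \<open>f(z) = (a + z)/(1 + a z)\<close>, \<open>\<omega>_n(z) = z^n\<close> and \<open>z = R\<close>: the Bohr sum equals \<open>1\<close> at
  \<open>a = 1\<close>, where its derivative in \<open>a\<close> is \<open>-\<Psi>_2(R) < 0\<close>, so it exceeds \<open>1\<close> for \<open>a\<close> slightly below \<open>1\<close>.\<close>

section \<open>Schwarz lemma for a zero of order \<open>n\<close>\<close>

text \<open>On the circle of radius \<open>\<rho>\<close> the hypothesis reads
  \<open>norm (g w) \<le> 1 / \<rho> ^ n\<close>. The maximum modulus principle carries this bound
  inside, and letting \<open>\<rho>\<close> tend to 1 from the left removes the factor
  \<open>\<rho> ^ n\<close>.\<close>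

lemma schwarz_factor:
  fixes g :: "complex \<Rightarrow> complex"
  assumes g: "g holomorphic_on ball 0 1"
    and bd: "\<And>z. z \<in> ball 0 1 \<Longrightarrow> norm (z ^ n * g z) \<le> 1"
    and z: "z \<in> ball 0 1"
  shows "norm (g z) \<le> 1"
proof -
  have *: "\<rho> ^ n * norm (g z) \<le> 1" if \<rho>: "norm z < \<rho>" "\<rho> < 1" for \<rho> :: real
  proof -
    have pos: "0 < \<rho>" using \<rho>(1) norm_ge_zero[of z] by linarith
    have sub: "cball 0 \<rho> \<subseteq> ball (0::complex) 1" using \<rho> by auto
    have "norm (g z) \<le> 1 / \<rho> ^ n"
    proof (rule maximum_modulus_frontier[where S = "cball 0 \<rho>" and f = g])
      show "g holomorphic_on interior (cball 0 \<rho>)"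
        using g sub by (meson holomorphic_on_subset interior_subset subset_trans)
      show "continuous_on (closure (cball 0 \<rho>)) g"
        using holomorphic_on_imp_continuous_on[OF g] sub continuous_on_subset by auto
      show "norm (g w) \<le> 1 / \<rho> ^ n" if "w \<in> frontier (cball 0 \<rho>)" for w
      proof -
        have w: "norm w = \<rho>" using that by (simp add: frontier_cball)
        then have "norm (w ^ n * g w) \<le> 1" using \<rho> by (intro bd) auto
        then show ?thesis using w pos
          by (simp add: norm_mult norm_power field_simps)
      qed
      show "z \<in> cball 0 \<rho>" using \<rho> by auto
    qed auto
    then show ?thesis using pos by (simp add: field_simps)
  qed
  have "\<forall>\<^sub>F \<rho> in at_left (1::real). \<rho> ^ n * norm (g z) \<le> 1"
    using z * by (auto simp: eventually_at_left intro!: exI[of _ "norm z"])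
  moreover have "((\<lambda>\<rho>::real. \<rho> ^ n * norm (g z)) \<longlongrightarrow> 1 ^ n * norm (g z)) (at_left 1)"
    by (intro tendsto_intros)
  ultimately show ?thesis
    using tendsto_upperbound[of "\<lambda>\<rho>. \<rho> ^ n * norm (g z)" "1 ^ n * norm (g z)" "at_left (1::real)" 1]
    by simp
qed

text \<open>The quotient is the shifted series with coefficients \<open>c (l + n)\<close>, so it
  needs no separate treatment of the removable singularity at 0. Its value \<open>c n\<close> there
  is what lets a bound on \<open>g\<close> at 0 bound a coefficient.\<close>

lemma power_series_factor:
  fixes c :: "nat \<Rightarrow> complex"
  assumes F: "\<And>z. z \<in> ball 0 1 \<Longrightarrow> (\<lambda>j. c j * z ^ j) sums F z"
    and c: "\<And>l. l < n \<Longrightarrow> c l = 0"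
  obtains g where "g holomorphic_on ball 0 1" "g 0 = c n"
    "\<And>z. z \<in> ball 0 1 \<Longrightarrow> F z = z ^ n * g z"
proof -
  define g where "g z = (\<Sum>l. c (l + n) * z ^ l)" for z
  have sm: "(\<lambda>l. c (l + n) * z ^ l) sums g z" if "z \<in> ball 0 1" for z
    using sums_summable[OF F[OF that]] unfolding g_def
    by (simp add: summable_powser_ignore_initial_segment summable_sums)
  have "g holomorphic_on ball 0 1"
    by (rule power_series_holomorphic[where a = "\<lambda>l. c (l + n)"]) (use sm in simp)
  moreover have "g 0 = c n" unfolding g_def using powser_zero[of "\<lambda>l. c (l + n)"] by simp
  moreover have "F z = z ^ n * g z" if z: "z \<in> ball 0 1" for z
  proof -
    have "(\<lambda>l. c (l + n) * z ^ (l + n)) sums (F z - (\<Sum>l<n. c l * z ^ l))"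
      using sums_split_initial_segment[OF F[OF z]] by simp
    moreover have "(\<Sum>l<n. c l * z ^ l) = 0" by (simp add: c)
    moreover have "(\<lambda>l. z ^ n * (c (l + n) * z ^ l)) sums (z ^ n * g z)"
      by (intro sums_mult sm z)
    ultimately show ?thesis
      by (auto simp: power_add mult_ac intro: sums_unique2)
  qed
  ultimately show thesis using that by blast
qed

lemma power_series_diff_const_factor:
  fixes c :: "nat \<Rightarrow> complex"
  assumes F: "\<And>z. z \<in> ball 0 1 \<Longrightarrow> (\<lambda>j. c j * z ^ j) sums F z"
    and n: "0 < n" and c: "\<And>l. 0 < l \<Longrightarrow> l < n \<Longrightarrow> c l = 0"
  obtains g where "g holomorphic_on ball 0 1" "g 0 = c n"
    "\<And>z. z \<in> ball 0 1 \<Longrightarrow> F z - c 0 = z ^ n * g z"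
proof -
  have "(\<lambda>l. (c(0 := 0)) l * z ^ l) sums (F z - c 0)" if "z \<in> ball 0 1" for z
  proof -
    have "(\<lambda>l. c l * z ^ l - (if l = 0 then c l * z ^ l else 0)) sums (F z - c 0 * z ^ 0)"
      by (intro sums_diff F that sums_single)
    moreover have "(\<lambda>l. c l * z ^ l - (if l = 0 then c l * z ^ l else 0))
        = (\<lambda>l. (c(0 := 0)) l * z ^ l)"
      by auto
    ultimately show ?thesis by simp
  qed
  moreover have "(c(0 := 0)) l = 0" if "l < n" for l using c that by simp
  ultimately obtain g where "g holomorphic_on ball 0 1" "g 0 = (c(0 := 0)) n"
    "\<And>z. z \<in> ball 0 1 \<Longrightarrow> F z - c 0 = z ^ n * g z"
    using power_series_factor[of "c(0 := 0)" "\<lambda>z. F z - c 0" n] by blast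
  then show thesis using that n by simp
qed

lemma norm_power_bound_of_order:
  assumes "\<omega> \<in> unit_ball_class_order n" "z \<in> ball 0 1"
  shows "norm (\<omega> z) \<le> norm z ^ n"
proof -
  have h: "\<omega> holomorphic_on ball 0 1" and b: "\<And>z. z \<in> ball 0 1 \<Longrightarrow> norm (\<omega> z) \<le> 1"
    and d: "\<And>i. i < n \<Longrightarrow> (deriv ^^ i) \<omega> 0 = 0"
    using assms(1) by (auto simp: unit_ball_class_order_def unit_ball_class_def analytic_imp_holomorphic)
  define c where "c j = (deriv ^^ j) \<omega> 0 / fact j" for j
  have "(\<lambda>j. c j * w ^ j) sums \<omega> w" if "w \<in> ball 0 1" for w
    using holomorphic_power_series[OF h that] by (simp add: c_def)
  moreover have "c i = 0" if "i < n" for i using d[OF that] by (simp add: c_def)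
  ultimately obtain g where g: "g holomorphic_on ball 0 1"
    "\<And>z. z \<in> ball 0 1 \<Longrightarrow> \<omega> z = z ^ n * g z"
    using power_series_factor[of c \<omega> n] by blast
  then have "norm (g z) \<le> 1"
    using schwarz_factor[of g n z] b assms(2) by metis
  then show ?thesis using g(2)[OF assms(2)]
    by (simp add: norm_mult norm_power mult_left_le)
qed

section \<open>Disc automorphisms and a power inequality\<close>

text \<open>The algebra behind the fact that \<open>(w - a) / (1 - cnj a * w)\<close> maps the unit
  disc to itself: both factors on the right are nonnegative there.\<close>

lemma norm_one_minus_cnj_mult_squared:
  fixes a w :: complex
  shows "(norm (1 - cnj a * w))\<^sup>2 - (norm (w - a))\<^sup>2 = (1 - (norm a)\<^sup>2) * (1 - (norm w)\<^sup>2)"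
  unfolding cmod_power2 by (simp add: algebra_simps power2_eq_square)

text \<open>Following \<open>F\<close> by the automorphism that sends \<open>a\<close> to 0 gives a
  self-map of the disc of the form \<open>z ^ n * g z\<close>, to which the Schwarz lemma applies.
  At \<open>z = 0\<close> the result bounds a coefficient; with \<open>n = 1\<close> and general
  \<open>z\<close> it is the Schwarz-Pick inequality.\<close>

lemma moebius_factor_bound:
  fixes a :: complex
  assumes F: "F holomorphic_on ball 0 1" "\<And>z. z \<in> ball 0 1 \<Longrightarrow> norm (F z) \<le> 1"
    and q: "q holomorphic_on ball 0 1" "\<And>z. z \<in> ball 0 1 \<Longrightarrow> F z - a = z ^ n * q z"
    and a: "norm a < 1" and z: "z \<in> ball 0 1"
  shows "norm (q z) \<le> norm (1 - cnj a * F z)"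
proof -
  \<comment> \<open>Strictness of \<open>norm a < 1\<close> enters here: \<open>F z\<close> may have
    modulus 1.\<close>
  have nz: "1 - cnj a * F z \<noteq> 0" if "z \<in> ball 0 1" for z
  proof
    assume "1 - cnj a * F z = 0"
    then have "norm (cnj a * F z) = 1" by (metis eq_iff_diff_eq_0 norm_one)
    moreover have "norm (cnj a * F z) < 1"
      using F(2)[OF that] a by (simp add: norm_mult) (meson le_less_trans mult_left_le norm_ge_zero)
    ultimately show False by simp
  qed
  define g where "g = (\<lambda>z. q z / (1 - cnj a * F z))"
  have "norm (g z) \<le> 1"
  proof (rule schwarz_factor[of g n])
    show "g holomorphic_on ball 0 1"
      unfolding g_def using F(1) q(1) nz by (intro holomorphic_intros) auto
    fix w :: complex assume w: "w \<in> ball 0 1"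
    have "0 \<le> (1 - (norm a)\<^sup>2) * (1 - (norm (F w))\<^sup>2)"
      using a F(2)[OF w] by (intro mult_nonneg_nonneg) (auto simp: power_le_one)
    then have "(norm (F w - a))\<^sup>2 \<le> (norm (1 - cnj a * F w))\<^sup>2"
      using norm_one_minus_cnj_mult_squared[of a "F w"] by linarith
    then have "norm (F w - a) \<le> norm (1 - cnj a * F w)"
      by (rule power2_le_imp_le) simp
    moreover have "w ^ n * g w = (F w - a) / (1 - cnj a * F w)"
      using q(2)[OF w] by (simp add: g_def)
    ultimately show "norm (w ^ n * g w) \<le> 1"
      using nz[OF w] by (simp add: norm_divide)
  qed (fact z)
  then show ?thesis using nz[OF z] by (simp add: g_def norm_divide divide_simps)
qed

text \<open>Weighted AM-GM for \<open>u\<^sup>2\<close> and 1 with weights \<open>p / 2\<close> and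
  \<open>1 - p / 2\<close>; the condition \<open>p \<le> 2\<close> makes the second weight
  nonnegative. The case \<open>u = 0\<close> uses \<open>0 powr p = 0\<close>.\<close>

lemma powr_le_of_le_two:
  fixes u p :: real
  assumes "0 \<le> u" "0 < p" "p \<le> 2"
  shows "u powr p \<le> 1 + p / 2 * (u\<^sup>2 - 1)"
proof (cases "u = 0")
  case False
  then have u: "0 < u" using assms by simp
  have "u powr p = (u\<^sup>2) powr (p / 2) * 1 powr (1 - p / 2)"
    using powr_powr[of u 2 "p / 2"] powr_realpow[of u 2] u by simp
  also have "\<dots> \<le> p / 2 * u\<^sup>2 + (1 - p / 2) * 1"
    by (rule Youngs_inequality_0) (use assms u in auto)
  finally show ?thesis by (simp add: algebra_simps)
qed (use assms in auto)

section \<open>Coefficient bounds by averaging over roots of unity\<close>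

text \<open>Exchanging the roles of \<open>i\<close> and \<open>l\<close> turns the sum into a
  geometric one whose ratio \<open>\<zeta>\<close> satisfies \<open>\<zeta> ^ j = 1\<close>, so it
  vanishes unless \<open>\<zeta> = 1\<close>.\<close>

lemma roots_of_unity_average:
  fixes j l :: nat
  assumes "0 < j"
  shows "(\<Sum>i<j. (exp (2 * complex_of_real pi * \<i> * of_nat i / of_nat j)) ^ l)
           = (if j dvd l then of_nat j else 0)"
proof -
  define \<zeta> where "\<zeta> = exp (2 * complex_of_real pi * \<i> * of_nat l / of_nat j)"
  have "(exp (2 * complex_of_real pi * \<i> * of_nat i / of_nat j)) ^ l = \<zeta> ^ i" for i
    unfolding \<zeta>_def exp_of_nat_mult[symmetric] by (simp add: mult_ac)
  moreover have "\<zeta> ^ j = 1"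
    unfolding \<zeta>_def using assms by (intro complex_root_unity) simp
  moreover have "\<zeta> = 1 \<longleftrightarrow> j dvd l"
    unfolding \<zeta>_def using assms by (intro complex_root_unity_eq_1) simp
  ultimately show ?thesis
    by (cases "\<zeta> = 1") (auto simp: sum_gp_strict)
qed

text \<open>Averaging over the rotations by \<open>j\<close>-th roots of unity removes the coefficients strictly
  between \<open>0\<close> and \<open>j\<close>, so that the difference with \<open>a 0\<close> vanishes to order \<open>j\<close> and the
  Schwarz lemma applies.\<close>
lemma coeff_bound_strict:
  fixes f :: "complex \<Rightarrow> complex" and a :: "nat \<Rightarrow> complex"
  assumes f: "\<And>z. z \<in> ball 0 1 \<Longrightarrow> norm (f z) \<le> 1"
    and ps: "\<And>z. z \<in> ball 0 1 \<Longrightarrow> (\<lambda>l. a l * z ^ l) sums f z"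
    and j: "0 < j" and a0: "norm (a 0) < 1"
  shows "norm (a j) \<le> 1 - (norm (a 0))\<^sup>2"
proof -
  define \<zeta> where "\<zeta> i = exp (2 * complex_of_real pi * \<i> * of_nat i / of_nat j)" for i
  have n\<zeta>: "norm (\<zeta> i) = 1" for i
    by (simp add: \<zeta>_def norm_exp_eq_Re)
  define F where "F z = (\<Sum>i<j. f (\<zeta> i * z)) / of_nat j" for z
  define c where "c l = (if j dvd l then a l else 0)" for l
  have Fs: "(\<lambda>l. c l * z ^ l) sums F z" if z: "z \<in> ball 0 1" for z
  proof -
    have "(\<lambda>l. a l * (\<zeta> i * z) ^ l) sums f (\<zeta> i * z)" for i
      by (intro ps) (use z n\<zeta> in \<open>simp add: norm_mult\<close>)
    then have "(\<lambda>l. (\<Sum>i<j. a l * (\<zeta> i * z) ^ l) / of_nat j) sums F z"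
      unfolding F_def by (intro sums_divide sums_sum)
    moreover have "(\<Sum>i<j. a l * (\<zeta> i * z) ^ l) / of_nat j = c l * z ^ l" for l
    proof -
      have "(\<Sum>i<j. a l * (\<zeta> i * z) ^ l) = a l * z ^ l * (\<Sum>i<j. \<zeta> i ^ l)"
        by (simp add: power_mult_distrib sum_distrib_left mult_ac)
      also have "(\<Sum>i<j. \<zeta> i ^ l) = (if j dvd l then of_nat j else 0)"
        unfolding \<zeta>_def by (rule roots_of_unity_average[OF j])
      finally show ?thesis using j by (simp add: c_def)
    qed
    ultimately show ?thesis by simp
  qed
  have Fb: "norm (F z) \<le> 1" if z: "z \<in> ball 0 1" for z
  proof -
    have "norm (\<Sum>i<j. f (\<zeta> i * z)) \<le> (\<Sum>i<j. 1)"
      by (intro sum_norm_le f) (use z n\<zeta> in \<open>simp add: norm_mult\<close>)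
    then show ?thesis using j by (simp add: F_def norm_divide)
  qed
  have Fh: "F holomorphic_on ball 0 1"
    by (rule power_series_holomorphic[where a = c]) (use Fs in simp)
  have "c 0 = a 0" "c j = a j" and "\<And>l. 0 < l \<Longrightarrow> l < j \<Longrightarrow> c l = 0"
    by (auto simp: c_def dvd_imp_le)
  then obtain q where q: "q holomorphic_on ball 0 1" "q 0 = a j"
    "\<And>z. z \<in> ball 0 1 \<Longrightarrow> F z - a 0 = z ^ j * q z"
    using power_series_diff_const_factor[OF Fs j] by metis
  have "F 0 = a 0" using q(3)[of 0] j by (simp add: zero_power)
  \<comment> \<open>The quotient \<open>q\<close> takes the value \<open>a j\<close> at 0, while
    \<open>F 0 = a 0\<close> makes the bound there equal to
    \<open>1 - (norm (a 0))\<^sup>2\<close>.\<close>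
  then have "norm (a j) \<le> norm (1 - cnj (a 0) * a 0)"
    using moebius_factor_bound[OF Fh Fb q(1) q(3) a0, of 0] q(2) by simp
  also have "1 - cnj (a 0) * a 0 = of_real (1 - (norm (a 0))\<^sup>2)"
    using complex_norm_square[of "a 0"] by (simp add: mult.commute)
  also have "norm \<dots> = 1 - (norm (a 0))\<^sup>2"
    unfolding norm_of_real by (rule abs_of_nonneg) (use a0 in \<open>simp add: power_le_one\<close>)
  finally show ?thesis .
qed

text \<open>Scaling \<open>f\<close> by \<open>e < 1\<close> makes the constant coefficient strictly
  smaller than 1, so the strict case applies to \<open>e * f\<close>; then \<open>e\<close> tends to
  1.\<close>

lemma coeff_bound:
  fixes f :: "complex \<Rightarrow> complex" and a :: "nat \<Rightarrow> complex"
  assumes f: "\<And>z. z \<in> ball 0 1 \<Longrightarrow> norm (f z) \<le> 1"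
    and ps: "\<And>z. z \<in> ball 0 1 \<Longrightarrow> (\<lambda>l. a l * z ^ l) sums f z"
    and j: "0 < j"
  shows "norm (a j) \<le> 1 - (norm (a 0))\<^sup>2"
proof -
  have "f 0 = a 0" using ps[of 0] powser_sums_zero[of a] sums_unique2 by fastforce
  then have a0: "norm (a 0) \<le> 1" using f[of 0] by simp
  have *: "e * norm (a j) \<le> 1 - (e * norm (a 0))\<^sup>2" if e: "0 < e" "e < 1" for e :: real
  proof -
    have "norm (of_real e * a j) \<le> 1 - (norm (of_real e * a 0))\<^sup>2"
    proof (rule coeff_bound_strict[where f = "\<lambda>z. of_real e * f z" and a = "\<lambda>l. of_real e * a l"])
      show "norm (of_real e * f z) \<le> 1" if "z \<in> ball 0 1" for z
        using f[OF that] e by (simp add: norm_mult mult_le_one)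
      show "(\<lambda>l. of_real e * a l * z ^ l) sums (of_real e * f z)" if "z \<in> ball 0 1" for z
        using sums_mult[OF ps[OF that], of "of_real e"] by (simp add: mult.assoc)
      show "norm (of_real e * a 0) < 1"
        using a0 e by (simp add: norm_mult) (meson le_less_trans mult_left_le less_imp_le)
    qed fact
    then show ?thesis using e by (simp add: norm_mult)
  qed
  have "\<forall>\<^sub>F e in at_left (1::real). e * norm (a j) \<le> 1 - (e * norm (a 0))\<^sup>2"
    using eventually_at_left_real[of 0 "1::real"] by (auto elim!: eventually_mono intro!: *)
  moreover have "((\<lambda>e::real. e * norm (a j)) \<longlongrightarrow> 1 * norm (a j)) (at_left 1)"
    by (intro tendsto_intros)
  moreover have "((\<lambda>e::real. 1 - (e * norm (a 0))\<^sup>2) \<longlongrightarrow> 1 - (1 * norm (a 0))\<^sup>2) (at_left 1)"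
    by (intro tendsto_intros)
  ultimately show ?thesis
    using tendsto_le[of "at_left (1::real)"] by fastforce
qed

section \<open>Schwarz-Pick bound in terms of the constant coefficient\<close>

text \<open>Schwarz-Pick between 0 and \<open>w\<close> yields
  \<open>u \<le> (A + x) / (1 + A * x)\<close>. Squaring this and enlarging the denominator to
  \<open>1 + x\<close> leaves \<open>A\<close> only in the factor \<open>1 - A\<^sup>2\<close>,
  which is the factor in the coefficient bound.\<close>

lemma schwarz_pick_at_zero:
  fixes f :: "complex \<Rightarrow> complex" and a :: "nat \<Rightarrow> complex"
  assumes f: "\<And>z. z \<in> ball 0 1 \<Longrightarrow> norm (f z) \<le> 1"
    and ps: "\<And>z. z \<in> ball 0 1 \<Longrightarrow> (\<lambda>l. a l * z ^ l) sums f z"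
    and w: "norm w \<le> x" and x: "x < 1"
  shows "(1 - (norm (a 0))\<^sup>2) * ((1 - x) / (1 + x)) \<le> 1 - (norm (f w))\<^sup>2"
proof -
  have w1: "w \<in> ball 0 1" using w x by simp
  have x0: "0 \<le> x" using w norm_ge_zero[of w] by linarith
  have f0: "f 0 = a 0" using ps[of 0] powser_sums_zero[of a] sums_unique2 by fastforce
  define A u where "A = norm (a 0)" and "u = norm (f w)"
  have A: "0 \<le> A" "A \<le> 1" and u: "0 \<le> u" "u \<le> 1"
    using f0 f[of 0] f[OF w1] by (auto simp: A_def u_def)
  show ?thesis
  proof (cases "A = 1")
    \<comment> \<open>The automorphism degenerates for \<open>A = 1\<close>, but the left side is
      then 0.\<close>
    case True
    then show ?thesis using u by (simp add: A_def[symmetric] u_def[symmetric] power_le_one)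
  next
    case False
    with A have A1: "A < 1" by simp
    have fh: "f holomorphic_on ball 0 1"
      by (rule power_series_holomorphic[where a = a]) (use ps in simp)
    obtain q where q: "q holomorphic_on ball 0 1"
      "\<And>z. z \<in> ball 0 1 \<Longrightarrow> f z - a 0 = z ^ 1 * q z"
      using power_series_diff_const_factor[OF ps, of 1] by auto
    define D where "D = norm (1 - cnj (a 0) * f w)"
    have "norm (q w) \<le> D"
      unfolding D_def using moebius_factor_bound[OF fh f q] A1 w1 by (simp add: A_def)
    moreover have "norm (f w - a 0) = norm w * norm (q w)"
      using q(2)[OF w1] by (simp add: norm_mult)
    ultimately have "norm (f w - a 0) \<le> x * D"
      using w x0 by (simp add: mult_mono)
    then have "(norm (f w - a 0))\<^sup>2 \<le> x\<^sup>2 * D\<^sup>2"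
      by (metis norm_ge_zero power_mono power_mult_distrib)
    then have 1: "(1 - x\<^sup>2) * D\<^sup>2 \<le> (1 - A\<^sup>2) * (1 - u\<^sup>2)"
      using norm_one_minus_cnj_mult_squared[of "a 0" "f w"]
      by (simp add: D_def A_def u_def algebra_simps)
    have "1 - A * u \<le> D"
      unfolding D_def A_def u_def using norm_triangle_ineq2[of 1 "cnj (a 0) * f w"]
      by (simp add: norm_mult)
    moreover have Au: "0 < 1 - A * u"
      using A1 u A by (smt (verit) mult_left_le)
    ultimately have 2: "(1 - A * u)\<^sup>2 \<le> D\<^sup>2" by (intro power_mono) auto
    have x2: "0 \<le> 1 - x\<^sup>2" using x x0 by (simp add: power_le_one)
    have "(1 - x\<^sup>2) * (1 - A * u)\<^sup>2 \<le> (1 - A\<^sup>2) * (1 - u\<^sup>2)"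
      using 1 2 mult_left_mono[OF 2 x2] by linarith
    \<comment> \<open>Rests on the real identity \<open>(1 - A * u)\<^sup>2 - (u - A)\<^sup>2 = (1 -
      A\<^sup>2) * (1 - u\<^sup>2)\<close>.\<close>
    then have "(u - A)\<^sup>2 \<le> (x * (1 - A * u))\<^sup>2"
      by (simp add: power2_eq_square algebra_simps)
    then have "u - A \<le> x * (1 - A * u)"
      by (rule power2_le_imp_le) (use x0 Au in simp)
    then have "u * (1 + A * x) \<le> A + x" by (simp add: algebra_simps)
    moreover have pos: "0 < 1 + A * x" using A x0 by (simp add: add_pos_nonneg)
    ultimately have "u \<le> (A + x) / (1 + A * x)" by (simp add: pos_le_divide_eq)
    then have "u\<^sup>2 \<le> ((A + x) / (1 + A * x))\<^sup>2" using u by (intro power_mono)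
    moreover have "1 - ((A + x) / (1 + A * x))\<^sup>2 = (1 - A\<^sup>2) * (1 - x\<^sup>2) / (1 + A * x)\<^sup>2"
    proof -
      have "(1 - A\<^sup>2) * (1 - x\<^sup>2) = (1 + A * x)\<^sup>2 - (A + x)\<^sup>2" by algebra
      then show ?thesis using pos by (simp add: power_divide diff_divide_distrib)
    qed
    moreover have "(1 - A\<^sup>2) * (1 - x\<^sup>2) / (1 + x)\<^sup>2 \<le> (1 - A\<^sup>2) * (1 - x\<^sup>2) / (1 + A * x)\<^sup>2"
    proof (intro divide_left_mono power_mono mult_nonneg_nonneg x2)
      show "1 + A * x \<le> 1 + x" using A x0 by (simp add: mult_left_le_one_le)
      show "0 \<le> 1 - A\<^sup>2" using A by (simp add: power_le_one)
    qed (use pos x0 in auto)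
    moreover have "(1 - x\<^sup>2) / (1 + x)\<^sup>2 = (1 - x) / (1 + x)"
    proof -
      have "1 - x\<^sup>2 = (1 - x) * (1 + x)" by algebra
      moreover have "1 + x \<noteq> 0" using x0 by linarith
      ultimately show ?thesis by (simp add: power2_eq_square)
    qed
    ultimately show ?thesis unfolding A_def[symmetric] u_def[symmetric]
      by (metis add_diff_cancel_left' diff_left_mono order_trans times_divide_eq_right)
  qed
qed

section \<open>Monotonicity of \<open>Psi2\<close> and its unique root\<close>

text \<open>The first fraction has a nondecreasing numerator and a nonincreasing positive
  denominator; strictness comes from the subtracted fraction, which decreases strictly in
  \<open>r ^ m\<close>.\<close>

lemma Psi2_strict_mono:
  assumes "1 \<le> k" "1 \<le> m" "1 \<le> s" "0 < p" "0 < lam" and xy: "0 \<le> x" "x < y" "y < 1"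
  shows "Psi2 p lam k m s t x < Psi2 p lam k m s t y"
proof -
  have "y ^ (k * s) < 1" using assms by (simp add: power_less_one_iff)
  moreover have "x ^ (k * s) \<le> y ^ (k * s)" "x ^ (k * (s + t)) \<le> y ^ (k * (s + t))"
    using xy by (auto intro!: power_mono)
  ultimately have "x ^ (k * (s + t)) / (1 - x ^ (k * s)) \<le> y ^ (k * (s + t)) / (1 - y ^ (k * s))"
    using xy by (intro frac_le) auto
  then have "2 * lam * (x ^ (k * (s + t)) / (1 - x ^ (k * s)))
      \<le> 2 * lam * (y ^ (k * (s + t)) / (1 - y ^ (k * s)))"
    using assms by (intro mult_left_mono) auto
  moreover have "x ^ m < y ^ m" "y ^ m < 1" "0 \<le> x ^ m"
    using assms by (auto simp: power_less_one_iff intro!: power_strict_mono)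
  then have "(1 - y ^ m) / (1 + y ^ m) < (1 - x ^ m) / (1 + x ^ m)"
    by (intro frac_less) auto
  then have "p * ((1 - y ^ m) / (1 + y ^ m)) < p * ((1 - x ^ m) / (1 + x ^ m))"
    using assms by (intro mult_strict_left_mono) auto
  ultimately show ?thesis unfolding Psi2_def by linarith
qed

lemma Psi2_unique_root:
  assumes k: "1 \<le> k" and m: "1 \<le> m" and s: "1 \<le> s" and p: "0 < p" and lam: "0 < lam"
  shows "\<exists>!r. 0 < r \<and> r < 1 \<and> Psi2 p lam k m s t r = 0"
proof -
  \<comment> \<open>Clearing denominators gives a function continuous on all of [0,1], including 1
    where the first denominator of \<open>Psi2\<close> vanishes, so the intermediate value theorem
    applies on the closed interval.\<close>
  define \<phi> where "\<phi> r = 2 * lam * r ^ (k * (s + t)) * (1 + r ^ m) - p * (1 - r ^ m) * (1 - r ^ (k * s))"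
    for r :: real
  have "\<phi> 0 < 0" "\<phi> 1 > 0" using assms by (auto simp: \<phi>_def zero_power)
  moreover have "continuous_on {0..1} \<phi>" unfolding \<phi>_def by (intro continuous_intros)
  ultimately obtain r where r: "0 \<le> r" "r \<le> 1" "\<phi> r = 0"
    using IVT'[of \<phi> 0 0 1] by auto
  then have r': "0 < r" "r < 1" using \<open>\<phi> 0 < 0\<close> \<open>\<phi> 1 > 0\<close> by (cases "r = 0"; cases "r = 1"; simp)+
  have frac: "2 * lam * (u / A) - p * (v / B) = (2 * lam * u * B - p * v * A) / (A * B)"
    if "A \<noteq> 0" "B \<noteq> 0" for u v A B :: real
    using that by (simp add: field_simps)
  have "0 < 1 + r ^ m" using r' by (simp add: add_pos_pos)
  moreover have "0 < 1 - r ^ (k * s)" using r' k s by (simp add: power_less_one_iff)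
  ultimately have "Psi2 p lam k m s t r = \<phi> r / ((1 - r ^ (k * s)) * (1 + r ^ m))"
    unfolding Psi2_def \<phi>_def by (intro frac) auto
  then have root: "Psi2 p lam k m s t r = 0" using r(3) by simp
  show ?thesis
  proof (rule ex1I[of _ r])
    fix r' assume "0 < r' \<and> r' < 1 \<and> Psi2 p lam k m s t r' = 0"
    then show "r' = r"
      using root r' Psi2_strict_mono[OF k m s p lam, where x = r and y = r' and t = t]
        Psi2_strict_mono[OF k m s p lam, where x = r' and y = r and t = t]
      by (cases r r' rule: linorder_cases) auto
  qed (use r' root in auto)
qed

section \<open>Extremal functions and their Bohr sums\<close>

lemma sums_power_arith_progression:
  fixes y :: real
  assumes "0 \<le> y" "y < 1" "0 < s"
  shows "(\<lambda>j. y ^ (s * Suc j + t)) sums (y ^ (s + t) / (1 - y ^ s))"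
proof -
  have "norm (y ^ s) < 1" using assms by (simp add: power_less_one_iff)
  then have "(\<lambda>j. y ^ (s + t) * (y ^ s) ^ j) sums (y ^ (s + t) * (1 / (1 - y ^ s)))"
    by (intro sums_mult geometric_sums)
  moreover have "y ^ (s + t) * (y ^ s) ^ j = y ^ (s * Suc j + t)" for j
    by (simp add: add_ac flip: power_mult power_add)
  ultimately show ?thesis by simp
qed

lemma power_in_unit_ball_class_order: "(\<lambda>z. z ^ n) \<in> unit_ball_class_order n"
proof -
  have "(\<lambda>z. z ^ n) analytic_on ball (0::complex) 1" by (intro analytic_intros)
  moreover have "norm (z ^ n) \<le> 1" if "z \<in> ball 0 1" for z :: complex
    using that by (simp add: norm_power power_le_one)
  \<comment> \<open>For \<open>i < n\<close> the factor \<open>0 ^ (n - i)\<close> vanishes; for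
    \<open>i = n\<close> it is \<open>0 ^ 0 = 1\<close>, which leaves
    \<open>pochhammer 1 n = fact n\<close>, so the order is exactly \<open>n\<close>.\<close>
  moreover have "(deriv ^^ i) (\<lambda>z::complex. z ^ n) 0 = pochhammer (of_nat (Suc n - i)) i * 0 ^ (n - i)" for i
    using higher_deriv_power[of i 0 n 0] by simp
  ultimately show ?thesis
    by (simp add: unit_ball_class_order_def unit_ball_class_def pochhammer_fact[symmetric] zero_power)
qed

lemma disc_automorphism_denom_nonzero:
  fixes z :: complex and a :: real
  assumes "0 < a" "a < 1" "norm z < 1"
  shows "1 + of_real a * z \<noteq> 0"
proof
  assume "1 + of_real a * z = 0"
  then have "norm (of_real a * z) = 1" by (metis add_eq_0_iff norm_minus_cancel norm_one)
  moreover have "a * norm z < 1 * 1" using assms by (intro mult_strict_mono) auto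
  ultimately show False using assms by (simp add: norm_mult)
qed

lemma disc_automorphism_in_unit_ball_class:
  fixes a :: real
  assumes a: "0 < a" "a < 1"
  shows "(\<lambda>z. (of_real a + z) / (1 + of_real a * z)) \<in> unit_ball_class"
proof -
  note nz = disc_automorphism_denom_nonzero[OF a]
  have "(\<lambda>z. (of_real a + z) / (1 + of_real a * z)) holomorphic_on ball 0 1"
    using nz by (intro holomorphic_intros) auto
  then have "(\<lambda>z. (of_real a + z) / (1 + of_real a * z)) analytic_on ball 0 1"
    by (simp add: analytic_on_open)
  moreover have "norm ((of_real a + z) / (1 + of_real a * z)) \<le> 1" if "z \<in> ball 0 1" for z :: complex
  proof -
    have "0 \<le> (1 - a\<^sup>2) * (1 - (norm z)\<^sup>2)"
      using a that by (intro mult_nonneg_nonneg) (auto simp: power_le_one)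
    moreover have "(norm (1 + of_real a * z))\<^sup>2 - (norm (of_real a + z))\<^sup>2
        = (1 - a\<^sup>2) * (1 - (norm z)\<^sup>2)"
      \<comment> \<open>The automorphism \<open>(a + z) / (1 + a * z)\<close> is the one centred at
        \<open>- a\<close>.\<close>
      using norm_one_minus_cnj_mult_squared[of "- of_real a" z] by (simp add: add.commute)
    ultimately have "(norm (of_real a + z))\<^sup>2 \<le> (norm (1 + of_real a * z))\<^sup>2" by linarith
    then have "norm (of_real a + z) \<le> norm (1 + of_real a * z)"
      by (rule power2_le_imp_le) simp
    then show ?thesis using nz[of z] that by (simp add: norm_divide)
  qed
  ultimately show ?thesis by (simp add: unit_ball_class_def)
qed

text \<open>For \<open>j > 0\<close> the coefficient is \<open>(1 - a\<^sup>2) (-a)^(j - 1)\<close>; dividing by \<open>a\<close> avoids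
  a truncated subtraction in the exponent.\<close>
definition disc_automorphism_coeff :: "real \<Rightarrow> nat \<Rightarrow> complex" where
  "disc_automorphism_coeff a j =
     (if j = 0 then of_real a else - of_real ((1 - a\<^sup>2) / a) * (- of_real a) ^ j)"

lemma disc_automorphism_power_series:
  fixes a :: real
  assumes a: "0 < a" "a < 1"
  shows "is_power_series_of (disc_automorphism_coeff a) (\<lambda>z. (of_real a + z) / (1 + of_real a * z))"
  unfolding is_power_series_of_def
proof
  fix z :: complex assume "z \<in> ball 0 1"
  then have z: "norm z < 1" by simp
  define q where "q = - of_real a * z"
  have "a * norm z < 1 * 1" using a z by (intro mult_strict_mono) auto
  then have "norm q < 1" using a by (simp add: q_def norm_mult)
  moreover define C :: complex where "C = - of_real ((1 - a\<^sup>2) / a)"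
  ultimately have "(\<lambda>j. C * q ^ j) sums (C * (1 / (1 - q)))"
    by (intro sums_mult geometric_sums)
  \<comment> \<open>The geometric series has constant term \<open>C\<close> where \<open>a\<close>
    is wanted; a series supported at index 0 corrects it.\<close>
  moreover have "(\<lambda>j. if j = 0 then of_real a - C else 0) sums (of_real a - C)"
    by (rule sums_single[of 0 "\<lambda>_. of_real a - C"])
  ultimately have "(\<lambda>j. C * q ^ j + (if j = 0 then of_real a - C else 0))
      sums (C * (1 / (1 - q)) + (of_real a - C))"
    by (rule sums_add)
  moreover have "C * q ^ j + (if j = 0 then of_real a - C else 0)
      = disc_automorphism_coeff a j * z ^ j" for j
    by (simp add: disc_automorphism_coeff_def C_def q_def power_mult_distrib[symmetric])
  moreover have "C * (1 / (1 - q)) + (of_real a - C) = (of_real a + z) / (1 + of_real a * z)"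
  proof -
    have "1 + of_real a * z \<noteq> 0" using disc_automorphism_denom_nonzero[OF a z] .
    moreover have "C * of_real a = (of_real a)\<^sup>2 - 1" using a by (simp add: C_def)
    ultimately show ?thesis
      using a by (simp add: q_def divide_simps) algebra
  qed
  ultimately show "(\<lambda>j. disc_automorphism_coeff a j * z ^ j) sums ((of_real a + z) / (1 + of_real a * z))"
    by simp
qed

text \<open>Since \<open>1 - a\<^sup>2\<close> vanishes at \<open>a = 1\<close>, the product rule
  leaves only its derivative -2 times the value of the other factor. The base of the power equals 1
  at \<open>a = 1\<close>, so its exponent contributes just the factor \<open>p\<close>.\<close>

lemma has_real_derivative_sharp_sum:
  fixes x y p lam :: real
  assumes x: "0 \<le> x" and y: "0 \<le> y" "y < 1" and n: "0 < n"
  shows "((\<lambda>a. ((a + x) / (1 + a * x)) powr p + lam * ((1 - a\<^sup>2) / a * ((a * y) ^ l / (1 - (a * y) ^ n))))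
     has_real_derivative (p * ((1 - x) / (1 + x)) - 2 * lam * (y ^ l / (1 - y ^ n)))) (at 1)"
proof -
  have x1: "1 + x \<noteq> 0" using x by linarith
  have "((\<lambda>a. (a + x) / (1 + a * x)) has_real_derivative
      (1 * (1 + x) - (1 + x) * x) / ((1 + x) * (1 + x))) (at 1)"
    using x1 by (auto intro!: derivative_eq_intros)
  moreover have "1 * (1 + x) - (1 + x) * x = (1 - x) * (1 + x)" by algebra
  ultimately have "((\<lambda>a. (a + x) / (1 + a * x)) has_real_derivative (1 - x) / (1 + x)) (at 1)"
    using x1 by simp
  from DERIV_fun_powr[OF this, of p]
  have D1: "((\<lambda>a. ((a + x) / (1 + a * x)) powr p) has_real_derivative p * ((1 - x) / (1 + x))) (at 1)"
    using x1 by (simp add: add.commute)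
  have yn: "1 - y ^ n \<noteq> 0" using y n by (simp add: power_less_one_iff less_imp_neq)
  \<comment> \<open>\<open>H\<close> collects everything besides \<open>1 - a\<^sup>2\<close>; its
    derivative is multiplied by 0, so differentiability suffices and no formula for it is
    computed.\<close>
  define H where "H a = (a * y) ^ l / (1 - (a * y) ^ n) / a" for a
  have "H field_differentiable (at 1)"
    unfolding H_def using yn by (intro derivative_intros) auto
  then obtain H' where H': "(H has_real_derivative H') (at 1)"
    by (auto simp: field_differentiable_def)
  have "((\<lambda>a. 1 - a\<^sup>2) has_real_derivative - 2) (at 1)"
    by (auto intro!: derivative_eq_intros)
  from DERIV_cmult[OF DERIV_mult[OF this H'], of lam]
  have "((\<lambda>a. lam * ((1 - a\<^sup>2) * H a)) has_real_derivative - 2 * lam * (y ^ l / (1 - y ^ n))) (at 1)"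
    by (simp add: H_def mult_ac)
  from DERIV_add[OF D1 this] show ?thesis by (simp add: H_def mult_ac)
qed

lemma bohr_term_sharp:
  fixes a R :: real
  assumes a: "0 < a" "a < 1" and R: "0 \<le> R" "R < 1" and k: "0 < k" and s: "0 < s"
  shows "bohr_term k s t (disc_automorphism_coeff a) (\<lambda>n z. z ^ n) (of_real R)
    sums ((1 - a\<^sup>2) / a * ((a * R ^ k) ^ (s + t) / (1 - (a * R ^ k) ^ s)))"
proof -
  have "R ^ k < 1" using R k by (simp add: power_less_one_iff)
  then have "a * R ^ k < 1 * 1" using a R by (intro mult_strict_mono) auto
  then have "(\<lambda>j. (1 - a\<^sup>2) / a * (a * R ^ k) ^ (s * Suc j + t))
      sums ((1 - a\<^sup>2) / a * ((a * R ^ k) ^ (s + t) / (1 - (a * R ^ k) ^ s)))"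
    using a R s by (intro sums_mult sums_power_arith_progression) auto
  moreover have "bohr_term k s t (disc_automorphism_coeff a) (\<lambda>n z. z ^ n) (of_real R)
      = (\<lambda>j. (1 - a\<^sup>2) / a * (a * R ^ k) ^ (s * Suc j + t))"
  proof
    fix j
    have "norm (disc_automorphism_coeff a n) = (1 - a\<^sup>2) / a * a ^ n" if "n \<noteq> 0" for n
    proof -
      have "0 \<le> (1 - a\<^sup>2) / a" using a by (simp add: power_le_one)
      then show ?thesis using that a
        by (simp only: disc_automorphism_coeff_def norm_mult norm_minus_cancel norm_power norm_of_real
            if_False abs_of_nonneg)
    qed
    then show "bohr_term k s t (disc_automorphism_coeff a) (\<lambda>n z. z ^ n) (of_real R) j
        = (1 - a\<^sup>2) / a * (a * R ^ k) ^ (s * Suc j + t)"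
      using R s
      by (simp add: bohr_term_def norm_power power_mult_distrib mult_ac)
  qed
  ultimately show ?thesis by (simp only:)
qed

section \<open>The Bohr inequality and its failure beyond the root\<close>

lemma bohr_inequality:
  assumes k: "1 \<le> k" and m: "1 \<le> m" and s: "1 \<le> s" and p: "0 < p" "p \<le> 2" and lam: "0 < lam"
    and f: "f \<in> unit_ball_class" and ps: "is_power_series_of a f"
    and \<omega>: "\<And>n. 1 \<le> n \<Longrightarrow> \<omega> n \<in> unit_ball_class_order n"
    and z: "norm z < 1" and Psi: "Psi2 p lam k m s t (norm z) \<le> 0"
  shows "summable (bohr_term k s t a \<omega> z) \<and> bohr_sum p lam k m s t f a \<omega> z \<le> 1"
proof -
  define r x y where "r = norm z" and "x = r ^ m" and "y = r ^ k"
  have r: "0 \<le> r" "r < 1" using z by (auto simp: r_def)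
  have x: "0 \<le> x" "x < 1" and y: "0 \<le> y" "y < 1"
    using r k m by (auto simp: x_def y_def power_less_one_iff)
  have wm: "norm (\<omega> m z) \<le> x" and wk: "norm (\<omega> k z) \<le> y"
    using norm_power_bound_of_order[OF \<omega>[OF m]] norm_power_bound_of_order[OF \<omega>[OF k]] z
    by (auto simp: x_def y_def r_def)
  have fb: "norm (f w) \<le> 1" if "w \<in> ball 0 1" for w
    using f that by (auto simp: unit_ball_class_def)
  have fs: "(\<lambda>l. a l * w ^ l) sums f w" if "w \<in> ball 0 1" for w
    using ps that by (auto simp: is_power_series_of_def)
  define B where "B = 1 - (norm (a 0))\<^sup>2"
  define S where "S = y ^ (s + t) / (1 - y ^ s)"
  \<comment> \<open>This geometric majorant serves twice: it gives summability by comparison, and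
    its sum \<open>B * S\<close> bounds the Bohr series.\<close>
  have dom: "(\<lambda>j. B * y ^ (s * Suc j + t)) sums (B * S)"
    unfolding S_def using y s by (intro sums_mult sums_power_arith_progression) auto
  have le: "bohr_term k s t a \<omega> z j \<le> B * y ^ (s * Suc j + t)" for j
  proof -
    have "norm (a (s * Suc j + t)) \<le> B"
      unfolding B_def by (rule coeff_bound[OF fb fs]) (use s in auto)
    moreover have "norm (\<omega> k z) ^ (s * Suc j + t) \<le> y ^ (s * Suc j + t)"
      using wk by (intro power_mono) auto
    ultimately show ?thesis unfolding bohr_term_def
      by (intro mult_mono) (auto intro: order_trans[OF norm_ge_zero])
  qed
  have sm: "summable (bohr_term k s t a \<omega> z)"
    by (rule summable_comparison_test'[OF sums_summable[OF dom], of 0])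
      (use le in \<open>simp add: bohr_term_def\<close>)
  then have "(\<Sum>j. bohr_term k s t a \<omega> z j) \<le> B * S"
    using suminf_le[OF le sm sums_summable[OF dom]] sums_unique[OF dom] by simp
  then have "lam * (\<Sum>j. bohr_term k s t a \<omega> z j) \<le> lam * (B * S)"
    using lam by (intro mult_left_mono) auto
  also have "lam * (B * S) \<le> p / 2 * (B * ((1 - x) / (1 + x)))"
  proof -
    \<comment> \<open>Being an upper bound for a norm shows that \<open>B\<close> is nonnegative, so
      \<open>Psi\<close> can be multiplied by it.\<close>
    have "norm (a 1) \<le> B" unfolding B_def by (rule coeff_bound[OF fb fs]) auto
    then have B: "0 \<le> B" using norm_ge_zero order_trans by blast
    have "lam * S \<le> p / 2 * ((1 - x) / (1 + x))"
      using Psi unfolding Psi2_def S_def x_def y_def r_def power_mult by linarith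
    from mult_left_mono[OF this B] show ?thesis by (simp add: mult_ac)
  qed
  also have "\<dots> \<le> p / 2 * (1 - (norm (f (\<omega> m z)))\<^sup>2)"
    unfolding B_def using schwarz_pick_at_zero[OF fb fs wm x(2)] p by (intro mult_left_mono) auto
  finally show ?thesis
    using sm powr_le_of_le_two[OF norm_ge_zero p, of "f (\<omega> m z)"]
    by (simp add: bohr_sum_def algebra_simps)
qed

lemma bohr_inequality_fails:
  assumes k: "1 \<le> k" and m: "1 \<le> m" and s: "1 \<le> s" and R: "0 < R" "R < 1"
    and Psi: "0 < Psi2 p lam k m s t R"
  shows "\<exists>f a \<omega> z. f \<in> unit_ball_class \<and> is_power_series_of a f
           \<and> (\<forall>n\<ge>1. \<omega> n \<in> unit_ball_class_order n) \<and> norm z \<le> R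
           \<and> summable (bohr_term k s t a \<omega> z) \<and> bohr_sum p lam k m s t f a \<omega> z > 1"
proof -
  define x y where "x = R ^ m" and "y = R ^ k"
  have x: "0 < x" and y: "0 \<le> y" "y < 1"
    using R k by (auto simp: x_def y_def power_less_one_iff)
  define G where "G a = ((a + x) / (1 + a * x)) powr p
      + lam * ((1 - a\<^sup>2) / a * ((a * y) ^ (s + t) / (1 - (a * y) ^ s)))" for a
  have "(G has_real_derivative - Psi2 p lam k m s t R) (at 1)"
    using has_real_derivative_sharp_sum[OF less_imp_le[OF x] y, of s p lam "s + t"] s
    by (simp add: G_def[abs_def] Psi2_def x_def y_def power_mult)
  then obtain d where d: "0 < d" "\<And>h. 0 < h \<Longrightarrow> h < d \<Longrightarrow> G 1 < G (1 - h)"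
    using DERIV_neg_dec_left Psi by (metis neg_less_0_iff_less)
  \<comment> \<open>The step \<open>d / 2\<close> stays within the range where \<open>G\<close>
    exceeds \<open>G 1\<close>; the cap \<open>1 / 2\<close> keeps \<open>a\<close>
    positive.\<close>
  define a where "a = 1 - min (d / 2) (1 / 2)"
  have a: "0 < a" "a < 1" using d(1) by (auto simp: a_def)
  have "G 1 < G a" unfolding a_def by (rule d(2)) (use d(1) in auto)
  moreover have "G 1 = 1" using x by (simp add: G_def add.commute)
  ultimately have G: "1 < G a" by simp
  define f where "f z = (of_real a + z) / (1 + of_real a * z)" for z :: complex
  have bs: "bohr_term k s t (disc_automorphism_coeff a) (\<lambda>n z. z ^ n) (of_real R)
      sums ((1 - a\<^sup>2) / a * ((a * y) ^ (s + t) / (1 - (a * y) ^ s)))"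
    unfolding y_def using bohr_term_sharp[OF a, of R k s t] R k s by simp
  have "f (of_real R ^ m) = of_real ((a + x) / (1 + a * x))"
    by (simp add: f_def x_def)
  then have "norm (f (of_real R ^ m)) = (a + x) / (1 + a * x)"
    using a x by (simp only: norm_of_real) (simp add: add_pos_pos)
  then have "bohr_sum p lam k m s t f (disc_automorphism_coeff a) (\<lambda>n z. z ^ n) (of_real R) = G a"
    using sums_unique[OF bs] by (simp add: bohr_sum_def G_def)
  moreover have "f \<in> unit_ball_class" "is_power_series_of (disc_automorphism_coeff a) f"
    using disc_automorphism_in_unit_ball_class[OF a] disc_automorphism_power_series[OF a]
    by (auto simp: f_def[abs_def])
  ultimately show ?thesis
    using G sums_summable[OF bs] R
    by (intro exI[of _ f] exI[of _ "disc_automorphism_coeff a"] exI[of _ "\<lambda>n z. z ^ n"]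
        exI[of _ "of_real R"]) (auto intro: power_in_unit_ball_class_order)
qed



theorem theorem2:
  fixes k m s t :: nat and p lam :: real
  assumes "1 \<le> k" and "1 \<le> m" and "2 \<le> s" and "0 < t" and "t < s"
    and "0 < p" and "p \<le> 2" and "0 < lam"
  shows
    "(\<exists>!r. 0 < r \<and> r < 1 \<and> Psi2 p lam k m s t r = 0)
     \<and> (\<forall>f a \<omega> z.
          f \<in> unit_ball_class \<and> is_power_series_of a f
          \<and> (\<forall>n\<ge>1. \<omega> n \<in> unit_ball_class_order n)
          \<and> norm z \<le> R2 p lam k m s t
          \<longrightarrow> summable (bohr_term k s t a \<omega> z) \<and> bohr_sum p lam k m s t f a \<omega> z \<le> 1)
     \<and> ((\<exists>\<epsilon>>0. \<forall>r. R2 p lam k m s t < r \<and> r < R2 p lam k m s t + \<epsilon>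
              \<longrightarrow> Psi2 p lam k m s t r > 0)
        \<longrightarrow> (\<forall>R. R2 p lam k m s t < R \<and> R < 1
              \<longrightarrow> (\<exists>f a \<omega> z.
                    f \<in> unit_ball_class \<and> is_power_series_of a f
                    \<and> (\<forall>n\<ge>1. \<omega> n \<in> unit_ball_class_order n)
                    \<and> norm z \<le> R
                    \<and> summable (bohr_term k s t a \<omega> z)
                    \<and> bohr_sum p lam k m s t f a \<omega> z > 1)))"
proof -
  have s: "1 \<le> s" using assms(3) by simp
  note uniq = Psi2_unique_root[OF assms(1,2) s assms(6,8), of t]
  note mono = Psi2_strict_mono[OF assms(1,2) s assms(6,8), of _ _ t]
  have root: "0 < R2 p lam k m s t" "R2 p lam k m s t < 1" "Psi2 p lam k m s t (R2 p lam k m s t) = 0"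
    using theI'[OF uniq] by (auto simp: R2_def)
  \<comment> \<open>Strict monotonicity around the root fixes the sign of \<open>Psi2\<close> on
    either side: nonpositive up to \<open>R2\<close> for the inequality, and positive between
    \<open>R2\<close> and 1 for the counterexamples.\<close>
  have "Psi2 p lam k m s t r \<le> 0" if "0 \<le> r" "r \<le> R2 p lam k m s t" for r
    using mono[of r "R2 p lam k m s t"] that root by (cases "r = R2 p lam k m s t") auto
  then have "summable (bohr_term k s t a \<omega> z) \<and> bohr_sum p lam k m s t f a \<omega> z \<le> 1"
    if "f \<in> unit_ball_class \<and> is_power_series_of a f
        \<and> (\<forall>n\<ge>1. \<omega> n \<in> unit_ball_class_order n) \<and> norm z \<le> R2 p lam k m s t" for f a \<omega> z
    using that root assms s by (intro bohr_inequality) auto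
  moreover have "\<exists>f a \<omega> z. f \<in> unit_ball_class \<and> is_power_series_of a f
           \<and> (\<forall>n\<ge>1. \<omega> n \<in> unit_ball_class_order n) \<and> norm z \<le> R
           \<and> summable (bohr_term k s t a \<omega> z) \<and> bohr_sum p lam k m s t f a \<omega> z > 1"
    if "R2 p lam k m s t < R \<and> R < 1" for R
    using mono[of "R2 p lam k m s t" R] that root assms(1,2) s by (intro bohr_inequality_fails) auto
  ultimately show ?thesis using uniq by blast
qed

end
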